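(* Let $R$ be a symmetric, log-avoiding, aperiodic random walk on $\mathbb{Z}$, and let $(A_n)$ be the (transient) DLA process with respect to $R$. Then almost surely $A_\infty=\mathbb{Z}$, where $A_\infty=\bigcup_nA_n$.
   Context: $R=(R_0,R_1,\dots)$ is a random walk on $\mathbb{Z}$ with i.i.d. steps distributed as an integer-valued variable $\xi$; $\mathbb{P}_x$ is its law started at $x$, and $p_{x,y}=\mathbb{P}(\xi=y-x)$. The walk is aperiodic if for all $x,y\in\mathbb{Z}$ there is $n$ with $\mathbb{P}_x(R_n=y)\ne0$. For $A\subset\mathbb{Z}$, $T_A=\min\{n>0:R_n\in A\}$ (with $\min\emptyset=\infty$). For finite $A\subset\mathbb{Z}$ and $x\in\mathbb{Z}$ (possibly in $A$), the escape probability is $E_A(x)=\mathbb{P}_x(T_A=\infty)$ and the capacity is $\operatorname{Cap}(A)=\sum_{a\in A}E_A(a)$. The walk is log-avoiding if there is $c>0$ such that $E_A(x)\ge\frac{c}{\log|A|}$ for every finite $A\subset\mathbb{Z}$ with $|A|\ge2$ and every $x\in\mathbb{Z}$. (Such a walk is transient.) For a symmetric transient walk, finite nonempty $A$, $x\notin A$, $a\in A$, the gluing measure is $\mu(x,a;A)=\frac{p_{x,a}E_A(x)}{\operatorname{Cap}(A)}$. The DLA process with respect to $R$ is the Markov chain of random finite sets $A_0=\{0\}\subset A_1\subset A_2\subset\cdots$ such that for all $n\ge0$, finite $A\subset\mathbb{Z}$ and $x\in\mathbb{Z}\setminus A$, $\mathbb{P}(A_{n+1}=A\cup\{x\}\mid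 A_n=A)=\sum_{a\in A}\mu(x,a;A)$. *)

theory Defs
  imports "HOL-Probability.Probability" "HOL-Library.Extended_Nat"
begin

text \<open>A random walk on the integers is given by its step distribution \<open>p :: int pmf\<close>,
  the law of \<open>\<xi>\<close>.\<close>

definition walk_law :: "int pmf \<Rightarrow> int \<Rightarrow> (nat \<Rightarrow> int) measure" where
  "walk_law p x =
     distr (\<Pi>\<^sub>M i\<in>UNIV. measure_pmf p) (\<Pi>\<^sub>M i\<in>UNIV. count_space UNIV)
       (\<lambda>\<xi> n. x + (\<Sum>i<n. \<xi> i))"

definition step_prob :: "int pmf \<Rightarrow> int \<Rightarrow> int \<Rightarrow> real" where
  "step_prob p x y = pmf p (y - x)"

definition symmetric_walk :: "int pmf \<Rightarrow> bool" where
  "symmetric_walk p \<longleftrightarrow> (\<forall>x y. step_prob p x y = step_prob p y x)"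

definition aperiodic_walk :: "int pmf \<Rightarrow> bool" where
  "aperiodic_walk p \<longleftrightarrow> (\<forall>x y. \<exists>n. \<P>(R in walk_law p x. R n = y) \<noteq> 0)"

text \<open>In \<open>enat\<close>, the infimum of the empty set is \<open>\<infinity>\<close>.\<close>

definition hitting_time :: "int set \<Rightarrow> (nat \<Rightarrow> int) \<Rightarrow> enat" where
  "hitting_time A R = Inf {enat n | n. n > 0 \<and> R n \<in> A}"

definition escape_prob :: "int pmf \<Rightarrow> int set \<Rightarrow> int \<Rightarrow> real" where
  "escape_prob p A x = \<P>(R in walk_law p x. hitting_time A R = \<infinity>)"

definition capacity :: "int pmf \<Rightarrow> int set \<Rightarrow> real" where
  "capacity p A = (\<Sum>a\<in>A. escape_prob p A a)"

definition log_avoiding :: "int pmf \<Rightarrow> bool" where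
  "log_avoiding p \<longleftrightarrow>
     (\<exists>c>0. \<forall>A x. finite A \<and> card A \<ge> 2 \<longrightarrow> escape_prob p A x \<ge> c / ln (real (card A)))"

text \<open>Only meant for finite nonempty \<open>A\<close>, \<open>x \<notin> A\<close> and \<open>a \<in> A\<close>.\<close>

definition gluing_measure :: "int pmf \<Rightarrow> int \<Rightarrow> int \<Rightarrow> int set \<Rightarrow> real" where
  "gluing_measure p x a A = step_prob p x a * escape_prob p A x / capacity p A"

text \<open>Conditional probabilities are prescribed only when the conditioning event has positive
  probability; otherwise \<open>cond_prob\<close> has the junk value \<open>0\<close>.\<close>

definition markov_chain :: "'w measure \<Rightarrow> (nat \<Rightarrow> 'w \<Rightarrow> 's) \<Rightarrow> bool" where
  "markov_chain M X \<longleftrightarrow>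
     (\<forall>n s t. \<P>(\<omega> in M. \<forall>i\<le>n. X i \<omega> = s i) > 0 \<longrightarrow>
        \<P>(\<omega> in M. X (Suc n) \<omega> = t \<bar> \<forall>i\<le>n. X i \<omega> = s i)
        = \<P>(\<omega> in M. X (Suc n) \<omega> = t \<bar> X n \<omega> = s n))"

text \<open>The collection of finite sets of integers is countable, so it carries the discrete
  sigma-algebra. The process may live on any probability space.\<close>

definition DLA_process :: "int pmf \<Rightarrow> 'w measure \<Rightarrow> (nat \<Rightarrow> 'w \<Rightarrow> int set) \<Rightarrow> bool" where
  "DLA_process p M X \<longleftrightarrow>
     prob_space M \<and>
     (\<forall>n. X n \<in> M \<rightarrow>\<^sub>M count_space (Collect finite)) \<and>
     (AE \<omega> in M. X 0 \<omega> = {0}) \<and>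
     (AE \<omega> in M. \<forall>n. X n \<omega> \<subseteq> X (Suc n) \<omega>) \<and>
     markov_chain M X \<and>
     (\<forall>n A x. finite A \<and> x \<notin> A \<and> \<P>(\<omega> in M. X n \<omega> = A) > 0 \<longrightarrow>
        \<P>(\<omega> in M. X (Suc n) \<omega> = A \<union> {x} \<bar> X n \<omega> = A) = (\<Sum>a\<in>A. gluing_measure p x a A))"

end

theory Submission
  imports Defs "HOL-Real_Asymp.Real_Asymp"
begin

text \<open>
  Adding points to \<open>A\<close> only lowers the escape probabilities, and \<open>Cap(A) \<le> |A|\<close>. By symmetry and
  a first-step analysis of \<open>E\<^sub>A\<close>, the gluing measure has total mass one, so \<open>|A\<^sub>n| \<le> n + 1\<close> almost
  surely. Hence, while \<open>a \<in> A\<^sub>n\<close>, \<open>x \<notin> A\<^sub>n\<close> and \<open>p\<^sub>a\<^sub>,\<^sub>x > 0\<close>, the conditional probability of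
  gluing \<open>x\<close> is at least a constant multiple of \<open>1 / (n log n)\<close>, whose sum diverges. On the other
  hand the events that \<open>x\<close> is glued at step \<open>n\<close> are disjoint, so their probabilities sum to at most
  one; this forces \<open>\<P>(a \<in> A\<^sub>\<infinity>, x \<notin> A\<^sub>\<infinity>) = 0\<close>. So \<open>A\<^sub>\<infinity>\<close> is closed under steps of positive
  probability, and aperiodicity gives everything.
\<close>

section \<open>The law of the walk and its first step\<close>

lemma walk_law_sets [measurable_cong]:
  "sets (walk_law p x) = sets (\<Pi>\<^sub>M i\<in>UNIV. count_space UNIV)"
  by (simp add: walk_law_def)

lemma walk_map_measurable [measurable]:
  "(\<lambda>\<xi> (n::nat). x + (\<Sum>i<n. \<xi> i) :: int)
     \<in> (\<Pi>\<^sub>M i\<in>UNIV. measure_pmf p) \<rightarrow>\<^sub>M (\<Pi>\<^sub>M i\<in>UNIV. count_space UNIV)"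
  for x :: int
proof (rule measurable_PiM_single'[where f="\<lambda>n \<xi>. x + (\<Sum>i<n. \<xi> i)"])
  fix n :: nat
  have [measurable]: "(\<lambda>\<xi>. \<xi> i) \<in> (\<Pi>\<^sub>M i\<in>UNIV. measure_pmf p) \<rightarrow>\<^sub>M count_space UNIV" for i :: nat
    using measurable_component_singleton[of i UNIV "\<lambda>_. measure_pmf p"]
    by (simp cong: measurable_cong_sets)
  show "(\<lambda>\<xi>. x + (\<Sum>i<n. \<xi> i)) \<in> (\<Pi>\<^sub>M i\<in>UNIV. measure_pmf p) \<rightarrow>\<^sub>M count_space UNIV"
  proof (induction n)
    case (Suc n)
    note [measurable] = Suc
    have "(\<lambda>\<xi>. (x + (\<Sum>i<n. \<xi> i)) + \<xi> n) \<in> (\<Pi>\<^sub>M i\<in>UNIV. measure_pmf p) \<rightarrow>\<^sub>M count_space UNIV"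
      by (rule measurable_compose_countable[where f="\<lambda>i \<xi>. i + \<xi> n", OF _ Suc])
        (rule measurable_compose[where f="\<lambda>\<xi>. \<xi> n" and N="count_space UNIV"], simp_all)
    then show ?case by (simp add: add.assoc)
  qed simp
qed simp

lemma prob_space_steps: "prob_space (\<Pi>\<^sub>M i\<in>(UNIV::nat set). measure_pmf p)"
  by (intro prob_space_PiM measure_pmf.prob_space_axioms)

lemma prob_space_walk_law: "prob_space (walk_law p x)"
  unfolding walk_law_def
  by (intro prob_space.prob_space_distr prob_space_steps walk_map_measurable)

text \<open>The Markov property at time one. An i.i.d. sequence is a first step \<open>s\<close>
  followed by an independent i.i.d. sequence, and once \<open>s\<close> is fixed, the path shifted
  by one is a walk started at \<open>x + s\<close>. Working in \<open>ennreal\<close> lets Tonelli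
  separate the two without integrability conditions.\<close>

lemma walk_law_first_step:
  assumes Q [measurable]: "Measurable.pred (\<Pi>\<^sub>M i\<in>UNIV. count_space UNIV) Q"
  shows "ennreal \<P>(R in walk_law p x. Q (\<lambda>n. R (Suc n)))
    = (\<integral>\<^sup>+s. ennreal \<P>(R in walk_law p (x + s). Q R) \<partial>measure_pmf p)"
proof -
  let ?S = "\<Pi>\<^sub>M i\<in>(UNIV::nat set). measure_pmf p"
  let ?C = "\<Pi>\<^sub>M i\<in>(UNIV::nat set). count_space (UNIV::int set)"
  interpret sequence_space "measure_pmf p" ..
  interpret W: prob_space "walk_law p y" for y
    by (rule prob_space_walk_law)
  have shift [measurable]: "(\<lambda>R n. R (Suc n)) \<in> ?C \<rightarrow>\<^sub>M ?C"
    by (rule measurable_PiM_single') simp_all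
  have em: "ennreal \<P>(R in walk_law p y. P R)
      = (\<integral>\<^sup>+\<xi>. indicator {\<xi>. P (\<lambda>n. y + (\<Sum>i<n. \<xi> i))} \<xi> \<partial>?S)"
    if [measurable]: "Measurable.pred ?C P" for P y
  proof -
    have "ennreal \<P>(R in walk_law p y. P R) = emeasure (walk_law p y) {R \<in> space (walk_law p y). P R}"
      by (simp add: W.emeasure_eq_measure)
    also have "\<dots> = emeasure ?S {\<xi>\<in>space ?S. P (\<lambda>n. y + (\<Sum>i<n. \<xi> i))}"
    proof -
      have "{R \<in> space ?C. P R} \<in> sets ?C" by measurable
      then show ?thesis
        unfolding walk_law_def
        by (subst emeasure_distr) (auto intro!: arg_cong2[where f=emeasure] simp: space_PiM)
    qed
    also have "\<dots> = (\<integral>\<^sup>+\<xi>. indicator {\<xi>\<in>space ?S. P (\<lambda>n. y + (\<Sum>i<n. \<xi> i))} \<xi> \<partial>?S)"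
      by (rule nn_integral_indicator[symmetric]) measurable
    finally show ?thesis by (simp add: space_PiM)
  qed
  have meas: "(\<lambda>\<xi>. indicator {\<xi>. P (\<lambda>n. y + (\<Sum>i<n. \<xi> i))} \<xi> :: ennreal) \<in> borel_measurable ?S"
    if [measurable]: "Measurable.pred ?C P" for P y
  proof -
    have "{\<xi>\<in>space ?S. P (\<lambda>n. y + (\<Sum>i<n. \<xi> i))} \<in> sets ?S" by measurable
    then show ?thesis by (simp add: space_PiM)
  qed
  let ?f = "\<lambda>\<xi>. indicator {\<xi>. Q (\<lambda>n. x + (\<Sum>i<Suc n. \<xi> i))} \<xi> :: ennreal"
  have f [measurable]: "?f \<in> borel_measurable ?S"
    using meas[of "\<lambda>R. Q (\<lambda>n. R (Suc n))" x] by simp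
  have "ennreal \<P>(R in walk_law p x. Q (\<lambda>n. R (Suc n))) = (\<integral>\<^sup>+\<xi>. ?f \<xi> \<partial>?S)"
    by (rule em) measurable
  \<comment> \<open>\<open>PiM_iter\<close>: prepending an independent step to the sequence of steps
    preserves its law.\<close>
  also have "\<dots> = (\<integral>\<^sup>+\<xi>. ?f \<xi> \<partial>distr (measure_pmf p \<Otimes>\<^sub>M ?S) ?S (\<lambda>(s, \<omega>). case_nat s \<omega>))"
    by (simp add: PiM_iter)
  also have "\<dots> = (\<integral>\<^sup>+z. ?f ((\<lambda>(s, \<omega>). case_nat s \<omega>) z) \<partial>(measure_pmf p \<Otimes>\<^sub>M ?S))"
    by (rule nn_integral_distr) measurable
  also have "\<dots> = (\<integral>\<^sup>+s. \<integral>\<^sup>+\<omega>. ?f (case_nat s \<omega>) \<partial>?S \<partial>measure_pmf p)"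
  proof -
    have "(\<lambda>(s, \<omega>). case_nat s \<omega>) \<in> measure_pmf p \<Otimes>\<^sub>M ?S \<rightarrow>\<^sub>M ?S"
      by measurable
    from P.nn_integral_fst[OF measurable_compose[OF this f]] show ?thesis
      by simp
  qed
  also have "\<dots> = (\<integral>\<^sup>+s. ennreal \<P>(R in walk_law p (x + s). Q R) \<partial>measure_pmf p)"
  proof (rule nn_integral_cong)
    fix s
    \<comment> \<open>Index shift: the first \<open>Suc n\<close> steps of
      \<open>case_nat s \<omega>\<close> are \<open>s\<close> and the first \<open>n\<close> steps
      of \<open>\<omega>\<close>.\<close>
    have "(\<lambda>n. x + (\<Sum>i<Suc n. case_nat s \<omega> i)) = (\<lambda>n. (x + s) + (\<Sum>i<n. \<omega> i))" for \<omega> :: "nat \<Rightarrow> int"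
      by (subst sum.lessThan_Suc_shift) (simp add: add.assoc)
    then have "(\<integral>\<^sup>+\<omega>. ?f (case_nat s \<omega>) \<partial>?S)
        = (\<integral>\<^sup>+\<xi>. indicator {\<xi>. Q (\<lambda>n. (x + s) + (\<Sum>i<n. \<xi> i))} \<xi> \<partial>?S)"
      by (intro nn_integral_cong) (simp add: indicator_def)
    also have "\<dots> = ennreal \<P>(R in walk_law p (x + s). Q R)"
      by (rule em[symmetric]) measurable
    finally show "(\<integral>\<^sup>+\<omega>. ?f (case_nat s \<omega>) \<partial>?S) = ennreal \<P>(R in walk_law p (x + s). Q R)" .
  qed
  finally show ?thesis .
qed

lemma walk_law_start: "AE R in walk_law p x. R 0 = x"
  unfolding walk_law_def by (subst AE_distr_iff) auto

section \<open>Escape probabilities and reachability\<close>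

lemma hitting_time_eq_infinity_iff: "hitting_time A R = \<infinity> \<longleftrightarrow> (\<forall>n. R (Suc n) \<notin> A)"
proof -
  have "hitting_time A R = \<infinity> \<longleftrightarrow> (\<forall>k\<in>{enat n | n. n > 0 \<and> R n \<in> A}. k = \<infinity>)"
    unfolding hitting_time_def by (simp add: Inf_top_conv flip: top_enat_def)
  also have "\<dots> \<longleftrightarrow> (\<forall>n. R (Suc n) \<notin> A)"
    by (auto simp: gr0_conv_Suc)
  finally show ?thesis .
qed

lemma escape_prob_eq: "escape_prob p A x = \<P>(R in walk_law p x. \<forall>n. R (Suc n) \<notin> A)"
  by (simp add: escape_prob_def hitting_time_eq_infinity_iff)

lemma escape_prob_nonneg: "0 \<le> escape_prob p A x"
  by (simp add: escape_prob_def)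

lemma escape_prob_le_1: "escape_prob p A x \<le> 1"
  unfolding escape_prob_def by (rule prob_space.prob_le_1[OF prob_space_walk_law])

lemma escape_prob_antimono:
  assumes "A \<subseteq> B"
  shows "escape_prob p B x \<le> escape_prob p A x"
proof -
  interpret prob_space "walk_law p x" by (rule prob_space_walk_law)
  show ?thesis
    unfolding escape_prob_eq using assms by (intro finite_measure_mono) auto
qed

text \<open>Escape from \<open>x\<close> ignores time 0, but the position \<open>y\<close> after the
  first step counts. From there the walk must avoid \<open>A\<close> at all times, time 0 included,
  which produces the factor \<open>indicator (- A) y\<close>.\<close>

lemma escape_prob_first_step:
  "ennreal (escape_prob p A x)
     = (\<integral>\<^sup>+y. ennreal (step_prob p x y) * (indicator (- A) y * ennreal (escape_prob p A y)) \<partial>count_space UNIV)"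
proof -
  have start: "\<P>(R in walk_law p y. \<forall>n. R n \<notin> A) = indicator (- A) y * escape_prob p A y" for y
  proof -
    interpret prob_space "walk_law p y" by (rule prob_space_walk_law)
    have "AE R in walk_law p y. (\<forall>n. R n \<notin> A) \<longleftrightarrow> y \<notin> A \<and> (\<forall>n. R (Suc n) \<notin> A)"
      using walk_law_start[of y p] by eventually_elim (metis not0_implies_Suc)
    then have "\<P>(R in walk_law p y. \<forall>n. R n \<notin> A)
        = \<P>(R in walk_law p y. y \<notin> A \<and> (\<forall>n. R (Suc n) \<notin> A))"
      by (rule prob_eq_AE) measurable
    then show ?thesis by (cases "y \<in> A") (simp_all add: escape_prob_eq)
  qed
  have "ennreal (escape_prob p A x)
      = (\<integral>\<^sup>+s. ennreal \<P>(R in walk_law p (x + s). \<forall>n. R n \<notin> A) \<partial>measure_pmf p)"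
    unfolding escape_prob_eq by (rule walk_law_first_step) measurable
  also have "\<dots> = (\<integral>\<^sup>+s. ennreal (pmf p s) * (indicator (- A) (x + s) * ennreal (escape_prob p A (x + s)))
      \<partial>count_space UNIV)"
    unfolding start by (simp add: nn_integral_measure_pmf ennreal_mult' ennreal_indicator)
  also have "\<dots> = (\<integral>\<^sup>+y. ennreal (step_prob p x y) * (indicator (- A) y * ennreal (escape_prob p A y))
      \<partial>count_space UNIV)"
    by (subst nn_integral_bij_count_space[where g="\<lambda>s. x + s" and A=UNIV and B=UNIV, symmetric])
      (auto simp: step_prob_def intro!: bij_betwI[where g="\<lambda>y. y - x"])
  finally show ?thesis .
qed

text \<open>Peel off the first step: if \<open>y\<close> is reachable from \<open>x\<close> in
  \<open>Suc n\<close> steps, some step of positive probability leads to a point from which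
  \<open>y\<close> is reachable in \<open>n\<close> steps, and that point is still in
  \<open>B\<close>. Hence the starting point varies in the induction.\<close>

lemma walk_path_induct:
  assumes step: "\<And>x y. x \<in> B \<Longrightarrow> step_prob p x y > 0 \<Longrightarrow> y \<in> B"
    and "x \<in> B" and "\<P>(R in walk_law p x. R n = y) \<noteq> 0"
  shows "y \<in> B"
  using assms(2,3)
proof (induction n arbitrary: x)
  case 0
  interpret prob_space "walk_law p x" by (rule prob_space_walk_law)
  have "\<P>(R in walk_law p x. R 0 = y) = \<P>(R in walk_law p x. x = y)"
    using walk_law_start[of x p] by (intro prob_eq_AE) auto
  with 0 show ?case by (cases "x = y") auto
next
  case (Suc n)
  have "ennreal \<P>(R in walk_law p x. R (Suc n) = y)
      = (\<integral>\<^sup>+s. ennreal \<P>(R in walk_law p (x + s). R n = y) \<partial>measure_pmf p)"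
    by (rule walk_law_first_step) measurable
  with Suc.prems have "\<not> (AE s in measure_pmf p. ennreal \<P>(R in walk_law p (x + s). R n = y) = 0)"
    by (subst nn_integral_0_iff_AE[symmetric]) auto
  then obtain s where s: "s \<in> set_pmf p" "\<P>(R in walk_law p (x + s). R n = y) \<noteq> 0"
    by (auto simp: AE_measure_pmf_iff)
  have "x + s \<in> B"
    using s(1) by (intro step[OF Suc.prems(1)]) (simp add: step_prob_def pmf_positive)
  with Suc.IH s(2) show ?case by blast
qed

section \<open>Log-avoidance, capacity and the gluing measure\<close>

text \<open>Log-avoidance says nothing about singletons, so an outside point \<open>z\<close> is
  added first. This only lowers the escape probability, and the enlarged set has between 2 and
  \<open>n + 2\<close> points, whence the \<open>ln (real n + 2)\<close>.\<close>

lemma log_avoidingE: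
  assumes "log_avoiding p"
  obtains c where "c > 0"
    and "\<And>A x n. finite A \<Longrightarrow> A \<noteq> {} \<Longrightarrow> card A \<le> Suc n \<Longrightarrow> c / ln (real n + 2) \<le> escape_prob p A x"
proof -
  obtain c where "c > 0"
    and c: "\<And>A x. finite A \<Longrightarrow> card A \<ge> 2 \<Longrightarrow> c / ln (real (card A)) \<le> escape_prob p A x"
    using assms by (auto simp: log_avoiding_def)
  have "c / ln (real n + 2) \<le> escape_prob p A x"
    if A: "finite A" "A \<noteq> {}" "card A \<le> Suc n" for A x n
  proof -
    obtain z where "z \<notin> A"
      using A(1) ex_new_if_finite infinite_UNIV_int by blast
    then have card: "card (insert z A) = Suc (card A)" "card A \<ge> 1"
      using A by (auto simp: Suc_le_eq card_gt_0_iff)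
    have "c / ln (real n + 2) \<le> c / ln (real (card (insert z A)))"
      using A(3) card \<open>c > 0\<close> by (intro divide_left_mono mult_pos_pos) auto
    also have "\<dots> \<le> escape_prob p (insert z A) x"
      using A(1) card by (intro c) auto
    also have "\<dots> \<le> escape_prob p A x"
      by (rule escape_prob_antimono) auto
    finally show ?thesis .
  qed
  with \<open>c > 0\<close> show thesis by (rule that)
qed

lemma capacity_le_card: "capacity p A \<le> real (card A)"
  unfolding capacity_def using sum_bounded_above[of A "escape_prob p A" 1] escape_prob_le_1 by simp

lemma capacity_pos:
  assumes "log_avoiding p" "finite A" "A \<noteq> {}"
  shows "capacity p A > 0"
proof -
  obtain c where c: "c > 0" "\<And>A x n. finite A \<Longrightarrow> A \<noteq> {} \<Longrightarrow> card A \<le> Suc n \<Longrightarrow> c / ln (real n + 2) \<le> escape_prob p A x"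
    using log_avoidingE[OF assms(1)] by blast
  have "0 < c / ln (real (card A) + 2)"
    using c(1) by simp
  then have "escape_prob p A x > 0" for x
    using c(2)[of A "card A" x] assms(2,3) by simp
  then show ?thesis
    unfolding capacity_def using assms(2,3) by (intro sum_pos) auto
qed

lemma gluing_measure_nonneg: "0 \<le> gluing_measure p x a A"
  by (simp add: gluing_measure_def step_prob_def capacity_def escape_prob_nonneg sum_nonneg)

text \<open>By symmetry \<open>step_prob p x a\<close> is \<open>step_prob p a x\<close>. Summing
  over \<open>x\<close> outside \<open>A\<close> then gives \<open>escape_prob p A a\<close> by the
  first-step formula, up to the factor \<open>1 / capacity p A\<close>, and summing over
  \<open>a\<close> gives the capacity, which cancels.\<close>

lemma gluing_measure_total:
  assumes sym: "symmetric_walk p" and A: "finite A" and pos: "capacity p A > 0"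
  shows "(\<integral>\<^sup>+x. ennreal (\<Sum>a\<in>A. gluing_measure p x a A) \<partial>count_space (- A)) = 1"
proof -
  have glue: "ennreal (gluing_measure p x a A)
      = ennreal (1 / capacity p A) * (ennreal (step_prob p a x) * ennreal (escape_prob p A x))" for x a
  proof -
    have "gluing_measure p x a A = 1 / capacity p A * (step_prob p a x * escape_prob p A x)"
      using sym by (simp add: gluing_measure_def symmetric_walk_def)
    then show ?thesis
      using pos by (simp add: ennreal_mult step_prob_def escape_prob_nonneg del: times_divide_eq_left)
  qed
  have "(\<integral>\<^sup>+x. ennreal (\<Sum>a\<in>A. gluing_measure p x a A) \<partial>count_space (- A))
      = (\<Sum>a\<in>A. \<integral>\<^sup>+x. ennreal (gluing_measure p x a A) \<partial>count_space (- A))"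
    by (subst nn_integral_sum[symmetric]) (simp_all add: gluing_measure_nonneg)
  also have "\<dots> = (\<Sum>a\<in>A. ennreal (1 / capacity p A) * ennreal (escape_prob p A a))"
  proof (rule sum.cong)
    fix a
    have "(\<integral>\<^sup>+x. ennreal (step_prob p a x) * ennreal (escape_prob p A x) \<partial>count_space (- A))
        = ennreal (escape_prob p A a)"
      unfolding escape_prob_first_step[of p A a]
      by (subst nn_integral_count_space_indicator) (auto simp: ac_simps)
    then show "(\<integral>\<^sup>+x. ennreal (gluing_measure p x a A) \<partial>count_space (- A))
        = ennreal (1 / capacity p A) * ennreal (escape_prob p A a)"
      unfolding glue by (simp add: nn_integral_cmult)
  qed simp
  also have "\<dots> = ennreal (1 / capacity p A * capacity p A)"
  proof -
    have "ennreal (capacity p A) = (\<Sum>a\<in>A. ennreal (escape_prob p A a))"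
      by (simp add: capacity_def escape_prob_nonneg)
    then show ?thesis
      using pos by (subst ennreal_mult) (auto simp: sum_distrib_left)
  qed
  also have "\<dots> = 1"
    using pos by simp
  finally show ?thesis .
qed

section \<open>A casewise comparison of probabilities and a divergent series\<close>

text \<open>Law of total probability over the countably many values of \<open>X\<close>. It replaces
  conditioning on \<open>X\<close>, so values of probability zero need no separate
  treatment.\<close>

lemma (in prob_space) prob_le_prob_casewise:
  fixes d :: real
  assumes X [measurable]: "X \<in> M \<rightarrow>\<^sub>M count_space I" and I: "countable I"
    and E [measurable]: "Measurable.pred M E" and F [measurable]: "Measurable.pred M F"
    and d: "0 \<le> d"
    and le: "\<And>A. A \<in> I \<Longrightarrow> d * \<P>(\<omega> in M. X \<omega> = A \<and> E \<omega>) \<le> \<P>(\<omega> in M. X \<omega> = A \<and> F \<omega>)"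
  shows "d * \<P>(\<omega> in M. E \<omega>) \<le> \<P>(\<omega> in M. F \<omega>)"
proof -
  have split: "emeasure M {\<omega>\<in>space M. G \<omega>} = (\<integral>\<^sup>+A. ennreal \<P>(\<omega> in M. X \<omega> = A \<and> G \<omega>) \<partial>count_space I)"
    if [measurable]: "Measurable.pred M G" for G
  proof -
    have "{\<omega>\<in>space M. G \<omega>} = (\<Union>A\<in>I. {\<omega>\<in>space M. X \<omega> = A \<and> G \<omega>})"
      using measurable_space[OF X] by auto
    also have "emeasure M \<dots> = (\<integral>\<^sup>+A. emeasure M {\<omega>\<in>space M. X \<omega> = A \<and> G \<omega>} \<partial>count_space I)"
      by (rule emeasure_UN_countable[OF _ I]) (auto simp: disjoint_family_on_def)
    finally show ?thesis by (simp add: emeasure_eq_measure)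
  qed
  have "ennreal (d * \<P>(\<omega> in M. E \<omega>)) = (\<integral>\<^sup>+A. ennreal (d * \<P>(\<omega> in M. X \<omega> = A \<and> E \<omega>)) \<partial>count_space I)"
    using d by (simp add: ennreal_mult' split[OF E, symmetric] emeasure_eq_measure nn_integral_cmult)
  also have "\<dots> \<le> (\<integral>\<^sup>+A. ennreal \<P>(\<omega> in M. X \<omega> = A \<and> F \<omega>) \<partial>count_space I)"
    using le by (intro nn_integral_mono ennreal_leI) auto
  also have "\<dots> = ennreal \<P>(\<omega> in M. F \<omega>)"
    by (simp add: split[OF F, symmetric] emeasure_eq_measure)
  finally show ?thesis by simp
qed

text \<open>A discrete integral test: \<open>ln (ln x)\<close> is an antiderivative of
  \<open>1 / (x * ln x)\<close>, and each of its increments is at most the corresponding term. Two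
  uses of \<open>ln (1 + t) \<le> t\<close> show this, first for the ratio of the logarithms, then
  for \<open>1 + 1 / ?x\<close>.\<close>

lemma sum_inverse_n_ln_n_ge:
  "(\<Sum>n<N. 1 / ((real n + 1) * ln (real n + 2))) \<ge> ln (ln (real N + 2)) - ln (ln 2)"
proof (induction N)
  case (Suc N)
  let ?x = "real N + 2"
  have "ln (ln (?x + 1)) - ln (ln ?x) = ln (ln (?x + 1) / ln ?x)"
    by (simp add: ln_div)
  also have "\<dots> \<le> ln (?x + 1) / ln ?x - 1"
    by (intro ln_le_minus_one) simp
  also have "\<dots> = ln (1 + 1 / ?x) / ln ?x"
    by (simp add: field_simps ln_div)
  also have "\<dots> \<le> (1 / ?x) / ln ?x"
    by (intro divide_right_mono ln_add_one_self_le_self) auto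
  also have "\<dots> \<le> 1 / ((real N + 1) * ln ?x)"
    unfolding divide_divide_eq_left
    by (intro divide_left_mono mult_right_mono mult_pos_pos) auto
  finally show ?case
    using Suc.IH by (simp add: add.commute add.left_commute)
qed simp

lemma not_summable_inverse_n_ln_n: "\<not> summable (\<lambda>n. 1 / ((real n + 1) * ln (real n + 2)))"
proof
  assume s: "summable (\<lambda>n. 1 / ((real n + 1) * ln (real n + 2)))"
  let ?b = "\<lambda>N. ln (ln (real N + 2)) - ln (ln 2)"
  have "?b N \<le> (\<Sum>n. 1 / ((real n + 1) * ln (real n + 2)))" for N
    using sum_inverse_n_ln_n_ge[of N] sum_le_suminf[OF s, of "{..<N}"] by fastforce
  moreover have "filterlim ?b at_top sequentially"
    by real_asymp
  then have "\<forall>\<^sub>F N in sequentially. (\<Sum>n. 1 / ((real n + 1) * ln (real n + 2))) < ?b N"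
    unfolding filterlim_at_top_dense by blast
  then have "\<exists>N. (\<Sum>n. 1 / ((real n + 1) * ln (real n + 2))) < ?b N"
    by (rule eventually_happens'[OF sequentially_bot])
  ultimately show False
    by (meson not_less)
qed

section \<open>One step of the DLA process\<close>

text \<open>\<open>Q\<close> can be arbitrary because the process takes values in a countable
  discrete space.\<close>

lemma DLA_process_measurable:
  assumes "DLA_process p M X"
  shows "Measurable.pred M (\<lambda>\<omega>. Q (X n \<omega>) (X m \<omega>))"
proof -
  have X: "X k \<in> M \<rightarrow>\<^sub>M count_space (Collect finite)" for k
    using assms by (simp add: DLA_process_def)
  show ?thesis
    by (rule measurable_compose_countable'[where f="\<lambda>A \<omega>. Q A (X m \<omega>)", OF _ X])
      (auto intro: measurable_compose[OF X] countable_Collect_finite)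
qed

text \<open>Joint probabilities in place of conditional ones remove the positivity condition: if
  \<open>X n \<omega> = A\<close> has probability zero, both sides vanish.\<close>

lemma DLA_process_step:
  assumes D: "DLA_process p M X" and A: "finite A" "x \<notin> A"
  shows "\<P>(\<omega> in M. X n \<omega> = A \<and> X (Suc n) \<omega> = insert x A)
    = \<P>(\<omega> in M. X n \<omega> = A) * (\<Sum>a\<in>A. gluing_measure p x a A)"
proof (cases "\<P>(\<omega> in M. X n \<omega> = A) > 0")
  case True
  then have "\<P>(\<omega> in M. X (Suc n) \<omega> = A \<union> {x} \<bar> X n \<omega> = A) = (\<Sum>a\<in>A. gluing_measure p x a A)"
    using D A by (simp add: DLA_process_def)
  with True show ?thesis
    by (simp add: cond_prob_def field_simps conj_commute)
next
  case False
  interpret prob_space M using D by (simp add: DLA_process_def)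
  note [measurable] = DLA_process_measurable[OF D, of "\<lambda>B C. B = A" n n]
  have "\<P>(\<omega> in M. X n \<omega> = A) = 0"
    using False by (simp add: zero_less_measure_iff)
  moreover have "\<P>(\<omega> in M. X n \<omega> = A \<and> X (Suc n) \<omega> = insert x A) \<le> \<P>(\<omega> in M. X n \<omega> = A)"
    by (rule finite_measure_mono) auto
  ultimately show ?thesis
    by (metis measure_le_0_iff mult_zero_left)
qed

text \<open>The transition rule speaks only of successors \<open>insert x A\<close>. Their
  conditional probabilities have total mass 1 by \<open>gluing_measure_total\<close>, so nothing is
  left for other successors, such as \<open>A\<close> itself or sets with several new
  points.\<close>

lemma DLA_process_grows_by_one:
  assumes D: "DLA_process p M X" and p: "symmetric_walk p" "log_avoiding p"
    and A: "finite A" "A \<noteq> {}"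
  shows "\<P>(\<omega> in M. X n \<omega> = A \<and> (\<exists>x. x \<notin> A \<and> X (Suc n) \<omega> = insert x A)) = \<P>(\<omega> in M. X n \<omega> = A)"
proof -
  interpret prob_space M using D by (simp add: DLA_process_def)
  let ?G = "\<lambda>x. {\<omega>\<in>space M. X n \<omega> = A \<and> X (Suc n) \<omega> = insert x A}"
  have G: "?G x \<in> sets M" for x
    using DLA_process_measurable[OF D, of "\<lambda>B C. B = A \<and> C = insert x A" n "Suc n"]
    by (simp add: pred_def)
  \<comment> \<open>A disjoint union, since distinct \<open>x\<close> outside \<open>A\<close> give
    distinct sets \<open>insert x A\<close>.\<close>
  have "{\<omega>\<in>space M. X n \<omega> = A \<and> (\<exists>x. x \<notin> A \<and> X (Suc n) \<omega> = insert x A)} = (\<Union>x\<in>- A. ?G x)"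
    by auto
  also have "emeasure M \<dots> = (\<integral>\<^sup>+x. emeasure M (?G x) \<partial>count_space (- A))"
    by (rule emeasure_UN_countable) (auto simp: G disjoint_family_on_def)
  also have "\<dots> = (\<integral>\<^sup>+x. ennreal \<P>(\<omega> in M. X n \<omega> = A) * ennreal (\<Sum>a\<in>A. gluing_measure p x a A) \<partial>count_space (- A))"
    using A by (intro nn_integral_cong)
      (simp add: emeasure_eq_measure DLA_process_step[OF D] ennreal_mult sum_nonneg gluing_measure_nonneg)
  also have "\<dots> = ennreal \<P>(\<omega> in M. X n \<omega> = A)"
    using A p by (simp add: nn_integral_cmult gluing_measure_total capacity_pos)
  finally show ?thesis
    by (simp add: emeasure_eq_measure)
qed

text \<open>That 0 is present keeps the set nonempty, so that
  \<open>DLA_process_grows_by_one\<close> applies in the induction step; the size bound is what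
  later controls both the escape probability and the capacity.\<close>

lemma DLA_process_invariant:
  assumes D: "DLA_process p M X" and p: "symmetric_walk p" "log_avoiding p"
  shows "AE \<omega> in M. 0 \<in> X n \<omega> \<and> card (X n \<omega>) \<le> Suc n"
proof (induction n)
  case 0
  have "AE \<omega> in M. X 0 \<omega> = {0}" using D by (simp add: DLA_process_def)
  then show ?case by eventually_elim simp
next
  case (Suc n)
  interpret prob_space M using D by (simp add: DLA_process_def)
  have X: "X n \<in> M \<rightarrow>\<^sub>M count_space (Collect finite)"
    using D by (simp add: DLA_process_def)
  let ?F = "\<lambda>\<omega>. card (X (Suc n) \<omega>) \<le> Suc (Suc n)"
  have F: "Measurable.pred M ?F"
    using DLA_process_measurable[OF D, of "\<lambda>B C. card C \<le> Suc (Suc n)" n "Suc n"] by simp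
  \<comment> \<open>With factor 1 and a trivial event on the left, the casewise comparison yields
    that \<open>?F\<close> has probability one.\<close>
  have "1 * \<P>(\<omega> in M. True) \<le> \<P>(\<omega> in M. ?F \<omega>)"
  proof (rule prob_le_prob_casewise[OF X countable_Collect_finite _ F])
    fix A assume "A \<in> Collect (finite :: int set \<Rightarrow> bool)"
    then have A: "finite A" by simp
    show "1 * \<P>(\<omega> in M. X n \<omega> = A \<and> True) \<le> \<P>(\<omega> in M. X n \<omega> = A \<and> ?F \<omega>)"
    proof (cases "0 \<in> A \<and> card A \<le> Suc n")
      case True
      have "\<P>(\<omega> in M. X n \<omega> = A) = \<P>(\<omega> in M. X n \<omega> = A \<and> (\<exists>x. x \<notin> A \<and> X (Suc n) \<omega> = insert x A))"
        using True by (intro DLA_process_grows_by_one[OF D p A, symmetric]) auto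
      also have "\<dots> \<le> \<P>(\<omega> in M. X n \<omega> = A \<and> ?F \<omega>)"
        using True A DLA_process_measurable[OF D, of "\<lambda>B C. B = A \<and> card C \<le> Suc (Suc n)" n "Suc n"]
        by (intro finite_measure_mono) (auto simp: pred_def)
      finally show ?thesis by simp
    next
      case False
      \<comment> \<open>The induction hypothesis makes such a value \<open>A\<close> null.\<close>
      have "AE \<omega> in M. X n \<omega> \<noteq> A"
        using Suc.IH by eventually_elim (use False in auto)
      then have "\<P>(\<omega> in M. X n \<omega> = A) = 0"
        by (subst prob_eq_0) (use DLA_process_measurable[OF D, of "\<lambda>B C. B = A" n n] in \<open>auto simp: pred_def\<close>)
      then show ?thesis by simp
    qed
  qed auto
  then have "AE \<omega> in M. ?F \<omega>"
    using F by (subst prob_Collect_eq_1[symmetric]) (auto simp: pred_def prob_space intro: antisym)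
  moreover have "AE \<omega> in M. \<forall>n. X n \<omega> \<subseteq> X (Suc n) \<omega>"
    using D by (simp add: DLA_process_def)
  ultimately show ?case
    using Suc.IH by eventually_elim auto
qed

section \<open>Absorption of neighbours and the conclusion\<close>

lemma DLA_process_absorbs_neighbour:
  assumes D: "DLA_process p M X" and p: "symmetric_walk p" "log_avoiding p"
    and q: "step_prob p a x > 0"
  shows "AE \<omega> in M. a \<in> (\<Union>n. X n \<omega>) \<longrightarrow> x \<in> (\<Union>n. X n \<omega>)"
proof -
  interpret prob_space M using D by (simp add: DLA_process_def)
  have X: "X n \<in> M \<rightarrow>\<^sub>M count_space (Collect finite)" for n
    using D by (simp add: DLA_process_def)
  note meas = DLA_process_measurable[OF D, unfolded pred_def]
  have [measurable]: "Measurable.pred M (\<lambda>\<omega>. y \<in> X n \<omega>)" for y n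
    using DLA_process_measurable[OF D, of "\<lambda>B C. y \<in> B" n n] .
  have mono: "AE \<omega> in M. \<forall>n. X n \<omega> \<subseteq> X (Suc n) \<omega>"
    using D by (simp add: DLA_process_def)
  obtain c where c: "c > 0"
    "\<And>A x n. finite A \<Longrightarrow> A \<noteq> {} \<Longrightarrow> card A \<le> Suc n \<Longrightarrow> c / ln (real n + 2) \<le> escape_prob p A x"
    using log_avoidingE[OF p(2)] by blast
  \<comment> \<open>\<open>k * w n\<close> will bound from below the chance of gluing
    \<open>x\<close> to a set of at most \<open>n + 1\<close> points containing \<open>a\<close> but
    not \<open>x\<close>; \<open>u n\<close> is the probability that \<open>x\<close> joins exactly
    between times \<open>n\<close> and \<open>n + 1\<close>.\<close>
  define k where "k = step_prob p a x * c"
  define w where "w n = 1 / ((real n + 1) * ln (real n + 2))" for n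
  define u where "u n = \<P>(\<omega> in M. x \<notin> X n \<omega> \<and> x \<in> X (Suc n) \<omega>)" for n
  have k: "k > 0" using q c(1) by (simp add: k_def)
  have w: "w n > 0" for n by (simp add: w_def)
  have hit: "k * w n * \<P>(\<omega> in M. a \<in> X n \<omega> \<and> x \<notin> X n \<omega>) \<le> u n" for n
    unfolding u_def
  proof (rule prob_le_prob_casewise[OF X countable_Collect_finite])
    fix A assume "A \<in> Collect (finite :: int set \<Rightarrow> bool)"
    then have A: "finite A" by simp
    show "k * w n * \<P>(\<omega> in M. X n \<omega> = A \<and> a \<in> X n \<omega> \<and> x \<notin> X n \<omega>)
      \<le> \<P>(\<omega> in M. X n \<omega> = A \<and> x \<notin> X n \<omega> \<and> x \<in> X (Suc n) \<omega>)"
    proof (cases "a \<in> A \<and> x \<notin> A \<and> card A \<le> Suc n")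
      case True
      then have ne: "A \<noteq> {}" by auto
      have cap: "capacity p A > 0" "capacity p A \<le> real n + 1"
        using capacity_pos[OF p(2) A ne] capacity_le_card[of p A] True by auto
      \<comment> \<open>In \<open>w n\<close>, the factor \<open>ln (real n + 2)\<close> comes from
        the lower bound on the escape probability and \<open>real n + 1\<close> from the upper bound
        on the capacity.\<close>
      have "k * w n = step_prob p a x * (c / ln (real n + 2)) / (real n + 1)"
        by (simp add: k_def w_def)
      also have "\<dots> \<le> step_prob p a x * escape_prob p A x / capacity p A"
        using c(2)[OF A ne, of n x] c(1) True q cap
        by (intro frac_le mult_left_mono mult_nonneg_nonneg escape_prob_nonneg) auto
      also have "\<dots> = gluing_measure p x a A"
        using p(1) by (simp add: gluing_measure_def symmetric_walk_def)
      \<comment> \<open>Gluing \<open>x\<close> through \<open>a\<close> is only one of the ways in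
        which \<open>x\<close> can join.\<close>
      also have "\<dots> \<le> (\<Sum>b\<in>A. gluing_measure p x b A)"
        using True A by (intro member_le_sum gluing_measure_nonneg) auto
      finally have "k * w n * \<P>(\<omega> in M. X n \<omega> = A)
          \<le> \<P>(\<omega> in M. X n \<omega> = A \<and> X (Suc n) \<omega> = insert x A)"
        using True A by (subst DLA_process_step[OF D]) (auto simp: mult.commute[of _ "\<P>(\<omega> in M. X n \<omega> = A)"] intro: mult_left_mono)
      also have "\<dots> \<le> \<P>(\<omega> in M. X n \<omega> = A \<and> x \<notin> X n \<omega> \<and> x \<in> X (Suc n) \<omega>)"
        using True meas[of "\<lambda>B C. B = A \<and> x \<notin> B \<and> x \<in> C" n "Suc n"]
        by (intro finite_measure_mono) auto
      also have "\<P>(\<omega> in M. X n \<omega> = A) = \<P>(\<omega> in M. X n \<omega> = A \<and> a \<in> X n \<omega> \<and> x \<notin> X n \<omega>)"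
        using True by (intro arg_cong[where f=prob]) auto
      finally show ?thesis .
    next
      case False
      \<comment> \<open>The event is either contradictory or violates the almost sure size
        bound.\<close>
      have "AE \<omega> in M. \<not> (X n \<omega> = A \<and> a \<in> X n \<omega> \<and> x \<notin> X n \<omega>)"
        using DLA_process_invariant[OF D p, of n] by eventually_elim (use False in auto)
      then have "\<P>(\<omega> in M. X n \<omega> = A \<and> a \<in> X n \<omega> \<and> x \<notin> X n \<omega>) = 0"
        by (subst prob_eq_0) (use meas[of "\<lambda>B C. B = A \<and> a \<in> B \<and> x \<notin> B" n n] in auto)
      then show ?thesis by simp
    qed
  qed (use k w in \<open>auto intro: less_imp_le\<close>)
  \<comment> \<open>The sets increase almost surely, so absence of \<open>x\<close> at time
    \<open>Suc n\<close> implies absence at time \<open>n\<close>. Hence \<open>u n\<close> is a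
    drop in the probability of absence, and the sum telescopes.\<close>
  have u: "u n = \<P>(\<omega> in M. x \<notin> X n \<omega>) - \<P>(\<omega> in M. x \<notin> X (Suc n) \<omega>)" for n
  proof -
    have "\<P>(\<omega> in M. x \<notin> X n \<omega>)
        = measure M ({\<omega>\<in>space M. x \<notin> X n \<omega> \<and> x \<in> X (Suc n) \<omega>} \<union> {\<omega>\<in>space M. x \<notin> X (Suc n) \<omega>})"
      using mono by (intro finite_measure_eq_AE) auto
    also have "\<dots> = u n + \<P>(\<omega> in M. x \<notin> X (Suc n) \<omega>)"
      unfolding u_def by (rule finite_measure_Union) auto
    finally show ?thesis by simp
  qed
  have "summable u"
  proof (rule summableI_nonneg_bounded)
    show "sum u {..<N} \<le> 1" for N
    proof -
      have "sum u {..<N} = \<P>(\<omega> in M. x \<notin> X 0 \<omega>) - \<P>(\<omega> in M. x \<notin> X N \<omega>)"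
        unfolding u by (rule sum_lessThan_telescope')
      also have "\<dots> \<le> 1"
        using prob_le_1[of "{\<omega>\<in>space M. x \<notin> X 0 \<omega>}"] measure_nonneg[of M "{\<omega>\<in>space M. x \<notin> X N \<omega>}"]
        by linarith
      finally show ?thesis .
    qed
  qed (simp add: u_def)
  \<comment> \<open>Fix a time \<open>m\<close> at which \<open>a\<close> is present. By
    monotonicity the event stays inside the one bounded in \<open>hit\<close> for all
    \<open>n \<ge> m\<close>, so its probability \<open>b\<close> satisfies
    \<open>k * b * w n \<le> u n\<close> there. As \<open>u\<close> is summable and \<open>w\<close>
    is not, \<open>k * b\<close> must be 0.\<close>
  have never: "AE \<omega> in M. \<not> (a \<in> X m \<omega> \<and> (\<forall>n. x \<notin> X n \<omega>))" for m
  proof -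
    define b where "b = \<P>(\<omega> in M. a \<in> X m \<omega> \<and> (\<forall>n. x \<notin> X n \<omega>))"
    have "norm (k * b * w n) \<le> u n" if "n \<ge> m" for n
    proof -
      have "AE \<omega> in M. a \<in> X m \<omega> \<and> (\<forall>n. x \<notin> X n \<omega>) \<longrightarrow> a \<in> X n \<omega> \<and> x \<notin> X n \<omega>"
        using mono
      proof eventually_elim
        case (elim \<omega>)
        then show ?case
          using lift_Suc_mono_le[of "\<lambda>n. X n \<omega>" m n] \<open>n \<ge> m\<close> by blast
      qed
      then have "b \<le> \<P>(\<omega> in M. a \<in> X n \<omega> \<and> x \<notin> X n \<omega>)"
        unfolding b_def by (intro finite_measure_mono_AE) auto
      then have "k * w n * b \<le> k * w n * \<P>(\<omega> in M. a \<in> X n \<omega> \<and> x \<notin> X n \<omega>)"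
        using k w[of n] by (intro mult_left_mono) auto
      also note hit
      finally show ?thesis
        using k w[of n] by (simp add: b_def abs_mult mult_ac)
    qed
    then have "summable (\<lambda>n. k * b * w n)"
      by (intro summable_comparison_test'[OF \<open>summable u\<close>])
    then have "k * b = 0"
      using not_summable_inverse_n_ln_n unfolding w_def summable_cmult_iff by blast
    then have "b = 0" using k by simp
    then show ?thesis
      unfolding b_def by (subst (asm) prob_eq_0) auto
  qed
  then have "AE \<omega> in M. \<forall>m. \<not> (a \<in> X m \<omega> \<and> (\<forall>n. x \<notin> X n \<omega>))"
    unfolding AE_all_countable by blast
  then show ?thesis
    by eventually_elim auto
qed

theorem theorem7p4:
  fixes p :: "int pmf" and M :: "'w measure" and X :: "nat \<Rightarrow> 'w \<Rightarrow> int set"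
  assumes "symmetric_walk p" and "log_avoiding p" and "aperiodic_walk p"
    and "DLA_process p M X"
  shows "AE \<omega> in M. (\<Union>n. X n \<omega>) = UNIV"
proof -
  have "AE \<omega> in M. \<forall>a x. step_prob p a x > 0 \<longrightarrow> a \<in> (\<Union>n. X n \<omega>) \<longrightarrow> x \<in> (\<Union>n. X n \<omega>)"
    \<comment> \<open>There are countably many pairs of integers, so one null set serves them
      all.\<close>
    unfolding AE_all_countable
  proof (intro allI)
    fix a x
    show "AE \<omega> in M. step_prob p a x > 0 \<longrightarrow> a \<in> (\<Union>n. X n \<omega>) \<longrightarrow> x \<in> (\<Union>n. X n \<omega>)"
    proof (cases "step_prob p a x > 0")
      case True
      then show ?thesis
        using DLA_process_absorbs_neighbour[OF assms(4,1,2) True] by simp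
    qed simp
  qed
  moreover have "AE \<omega> in M. X 0 \<omega> = {0}"
    using assms(4) by (simp add: DLA_process_def)
  ultimately show ?thesis
  proof eventually_elim
    case (elim \<omega>)
    have "y \<in> (\<Union>n. X n \<omega>)" for y
    proof -
      have "0 \<in> (\<Union>n. X n \<omega>)"
        using elim(2) by blast
      moreover obtain n where "\<P>(R in walk_law p 0. R n = y) \<noteq> 0"
        using assms(3) by (auto simp: aperiodic_walk_def)
      \<comment> \<open>For a fixed outcome, \<open>walk_path_induct\<close> is applied with the
        limit set as \<open>B\<close>, following the walk from 0 to \<open>y\<close>.\<close>
      ultimately show ?thesis
        by (rule walk_path_induct[rotated]) (use elim(1) in blast)
    qed
    then show ?case by blast
  qed
qed

end
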